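(* Let $m \geq 1$ and $k \geq 2$ be integers, let $w$ be an $m$-weighting of a graph $G$, and let $A = \{a_1,\ldots,a_r\}$ and $B = \{b_1,\ldots,b_r\}$ be disjoint $r$-element subsets of $V(G)$ such that (1) $a_i b_i \in E(G)$ for each $i \in [r]$; (2) $B$ is an independent set of $G$; and (3) $N_G(b_i) \setminus \left(A \cup \{v \in V(G) : w(v) = 0\}\right) \subseteq N_G(a_i)$ for each $i \in [r]$. Let $w'$ be the $m$-weighting of $G$ defined by $w'(v) = 0$ if $v \in A$, $w'(b_i) = w(b_i) + w(a_i)$ for each $i \in [r]$, and $w'(v) = w(v)$ for all other $v \in V(G)$. Then $\pi_k(G(w')) \leq \pi_k(G(w))$.
   Context: All graphs are simple. $\mathbb{N}_0 = \{0,1,2,\dots\}$, $[r] = \{1,\dots,r\}$. $N_G(v)$ denotes the set of neighbours of $v$ in $G$. For a graph $G$, a function $w: V(G) \to \mathbb{N}_0$ with $\sum_{v \in V(G)} w(v) = m$ is an $m$-weighting of $G$. $G(w)$ is the graph obtained from $G$ by replacing each vertex $v$ by a clique $K^v$ on $w(v)$ vertices and joining every vertex of $K^u$ to every vertex of $K^v$ whenever $uv \in E(G)$. $\pi_k(H)$ denotes the number of $k$-cliques of a graph $H$. *)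

theory Defs
  imports Complex_Main "HOL-Library.Ramsey"
begin

text \<open>
  A simple graph is a vertex set \<open>V\<close> with a set \<open>E\<close> of two-element subsets of \<open>V\<close>, which is the
  representation used by \<^const>\<open>clique\<close> and \<^const>\<open>indep\<close>. The vertex set may be infinite.
\<close>

definition simple_graph :: "'a set \<Rightarrow> 'a set set \<Rightarrow> bool" where
  "simple_graph V E \<longleftrightarrow> E \<subseteq> nsets V 2"

definition nbrs :: "'a set set \<Rightarrow> 'a \<Rightarrow> 'a set" where
  "nbrs E v = {u. {u, v} \<in> E}"

text \<open>
  A family of natural numbers with a finite sum has finite support. Summing over the support avoids
  the convention that \<^const>\<open>sum\<close> is \<open>0\<close> on infinite sets; for finite \<open>V\<close> the condition is just
  \<open>sum w V = m\<close>. Values of \<open>w\<close> outside \<open>V\<close> are irrelevant.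
\<close>

definition weighting :: "'a set \<Rightarrow> ('a \<Rightarrow> nat) \<Rightarrow> nat \<Rightarrow> bool" where
  "weighting V w m \<longleftrightarrow> finite {v \<in> V. w v \<noteq> 0} \<and> (\<Sum>v\<in>{v \<in> V. w v \<noteq> 0}. w v) = m"

lemma weighting_finite: "finite V \<Longrightarrow> weighting V w m \<longleftrightarrow> sum w V = m"
proof -
  assume "finite V"
  then have "(\<Sum>v\<in>{v \<in> V. w v \<noteq> 0}. w v) = sum w V"
    by (intro sum.mono_neutral_left) auto
  with \<open>finite V\<close> show ?thesis
    by (simp add: weighting_def)
qed

text \<open>The clique replacing \<open>v\<close> in the blow-up has vertices \<open>(v, 0), \<dots>, (v, w v - 1)\<close>.\<close>

definition blowup_verts :: "'a set \<Rightarrow> ('a \<Rightarrow> nat) \<Rightarrow> ('a \<times> nat) set" where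
  "blowup_verts V w = (SIGMA v:V. {..<w v})"

definition blowup_edges :: "'a set \<Rightarrow> 'a set set \<Rightarrow> ('a \<Rightarrow> nat) \<Rightarrow> ('a \<times> nat) set set" where
  "blowup_edges V E w =
     {{x, y} | x y. x \<in> blowup_verts V w \<and> y \<in> blowup_verts V w \<and> x \<noteq> y \<and>
                    (fst x = fst y \<or> {fst x, fst y} \<in> E)}"

lemma simple_graph_blowup: "simple_graph (blowup_verts V w) (blowup_edges V E w)"
  by (auto simp: simple_graph_def blowup_edges_def)

definition num_cliques :: "nat \<Rightarrow> 'a set \<Rightarrow> 'a set set \<Rightarrow> nat" where
  "num_cliques k V E = card {K \<in> nsets V k. clique K E}"

end

theory Submission
  imports Defs
begin

text \<open>
  Both \<open>G(w)\<close> and \<open>G(w')\<close> have the same vertices, once the \<open>w (a\<^sub>i)\<close> extra copies of \<open>b\<^sub>i\<close> in \<open>G(w')\<close>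
  are identified with the copies of \<open>a\<^sub>i\<close> in \<open>G(w)\<close>. Under this identification every edge of \<open>G(w')\<close>
  is an edge of \<open>G(w)\<close>: copies of \<open>b\<^sub>i\<close> stay adjacent because \<open>a\<^sub>i b\<^sub>i\<close> is an edge, and a neighbour of
  a moved copy lies over a neighbour of \<open>b\<^sub>i\<close> outside \<open>A \<union> B\<close> of positive weight, hence over a
  neighbour of \<open>a\<^sub>i\<close>.
\<close>

text \<open>The total weight counts the vertices of the blow-up, so a bijection between blow-ups
  transfers it. For infinite support, \<open>card\<close> defaults to 0; \<open>m \<ge> 1\<close>
  rules this case out.\<close>

lemma weighting_iff_card_blowup_verts:
  assumes "m \<ge> 1"
  shows "weighting V w m \<longleftrightarrow> card (blowup_verts V w) = m"
proof -
  let ?S = "{v \<in> V. w v \<noteq> 0}"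
  have eq: "blowup_verts V w = (SIGMA v:?S. {..<w v})"
    by (auto simp: blowup_verts_def)
  \<comment> \<open>Each vertex of positive weight has a copy, so the support is a projection of the
    blow-up and inherits its finiteness.\<close>
  have "?S = fst ` blowup_verts V w"
    unfolding eq fst_image_Sigma by (auto simp: lessThan_empty_iff)
  then have fin: "finite ?S" if "finite (blowup_verts V w)"
    using that by simp
  have card: "card (blowup_verts V w) = sum w ?S" if "finite ?S"
    unfolding eq using that by (subst card_SigmaI) auto
  show ?thesis
  proof
    assume "weighting V w m"
    then show "card (blowup_verts V w) = m"
      using card by (simp add: weighting_def)
  next
    assume m: "card (blowup_verts V w) = m"
    then have "finite ?S"
      using assms by (intro fin card_ge_0_finite) simp
    then show "weighting V w m"
      using card m by (simp add: weighting_def)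
  qed
qed

text \<open>Taking images under \<open>f\<close> maps k-cliques injectively to k-cliques:
  injectivity keeps both the size and the distinctness of vertex sets. Finiteness of
  \<open>V'\<close> makes the comparison of cardinalities valid.\<close>

lemma num_cliques_mono_inj_hom:
  assumes "finite V'" and inj: "inj_on f V" and "f ` V \<subseteq> V'"
    and hom: "\<And>x y. x \<in> V \<Longrightarrow> y \<in> V \<Longrightarrow> x \<noteq> y \<Longrightarrow> {x, y} \<in> E \<Longrightarrow> {f x, f y} \<in> E'"
  shows "num_cliques k V E \<le> num_cliques k V' E'"
  unfolding num_cliques_def
proof (rule card_inj_on_le)
  show "inj_on (image f) {K \<in> nsets V k. clique K E}"
    by (rule inj_onI) (auto simp: nsets_def inj_on_image_eq_iff[OF inj])
  show "image f ` {K \<in> nsets V k. clique K E} \<subseteq> {K \<in> nsets V' k. clique K E'}"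
  proof clarify
    fix K assume K: "K \<in> nsets V k" "clique K E"
    then have "K \<subseteq> V" "finite K" "card K = k"
      by (auto simp: nsets_def)
    then have "f ` K \<in> nsets V' k"
      using assms(3) card_image[OF inj_on_subset[OF inj]] by (auto simp: nsets_def)
    moreover have "clique (f ` K) E'"
      unfolding clique_def
    proof clarify
      fix x y assume "x \<in> K" "y \<in> K" "f x \<noteq> f y"
      then show "{f x, f y} \<in> E'"
        using K(2) \<open>K \<subseteq> V\<close> by (intro hom) (auto simp: clique_def)
    qed
    ultimately show "f ` K \<in> nsets V' k \<and> clique (f ` K) E'" by simp
  qed
  show "finite {K \<in> nsets V' k. clique K E'}"
    using \<open>finite V'\<close> by (simp add: finite_imp_finite_nsets)
qed

lemma doubleton_mem_blowup_edges_iff: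
  "{x, y} \<in> blowup_edges V E w \<longleftrightarrow>
     x \<in> blowup_verts V w \<and> y \<in> blowup_verts V w \<and> x \<noteq> y \<and> (fst x = fst y \<or> {fst x, fst y} \<in> E)"
  (is "?L \<longleftrightarrow> ?R")
proof
  show ?R if ?L
    using that unfolding blowup_edges_def by (auto simp: doubleton_eq_iff insert_commute)
  show ?L if ?R
    using that unfolding blowup_edges_def by blast
qed

text \<open>Here \<open>p\<close> stands for the map from \<open>b\<^sub>i\<close> to
  \<open>a\<^sub>i\<close>. Copies over \<open>B\<close> with index at least \<open>w v\<close> are
  the extra ones in G(w'); the subtraction renumbers them from 0.\<close>

definition shift_copies :: "'a set \<Rightarrow> ('a \<Rightarrow> 'a) \<Rightarrow> ('a \<Rightarrow> nat) \<Rightarrow> 'a \<times> nat \<Rightarrow> 'a \<times> nat" where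
  "shift_copies B p w = (\<lambda>(v, j). if v \<in> B \<and> w v \<le> j then (p v, j - w v) else (v, j))"

text \<open>G(w') has no copies over \<open>A\<close>, so the moved copies never collide with the
  fixed ones and fill exactly the cliques over \<open>A\<close> in G(w).\<close>

lemma bij_betw_shift_copies:
  assumes p: "bij_betw p B A" and sub: "A \<subseteq> V" "B \<subseteq> V"
    and wA: "\<And>v. v \<in> A \<Longrightarrow> w' v = 0"
    and wB: "\<And>v. v \<in> B \<Longrightarrow> w' v = w v + w (p v)"
    and wo: "\<And>v. v \<in> V - (A \<union> B) \<Longrightarrow> w' v = w v"
  shows "bij_betw (shift_copies B p w) (blowup_verts V w') (blowup_verts V w)"
proof -
  have pA: "p v \<in> A" if "v \<in> B" for v
    using p that by (auto simp: bij_betw_def)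
  have pinj: "p u = p v \<Longrightarrow> u = v" if "u \<in> B" "v \<in> B" for u v
    using p that by (auto simp: bij_betw_def inj_on_def)
  have notA: "v \<notin> A" if "(v, j) \<in> blowup_verts V w'" for v j
    using that wA by (auto simp: blowup_verts_def)
  have "inj_on (shift_copies B p w) (blowup_verts V w')"
  proof (rule inj_onI)
    fix x y assume xy: "x \<in> blowup_verts V w'" "y \<in> blowup_verts V w'"
      "shift_copies B p w x = shift_copies B p w y"
    obtain u i v j where "x = (u, i)" "y = (v, j)" by fastforce
    then show "x = y"
      using xy notA[of u i] notA[of v j] pA[of u] pA[of v] pinj[of u v]
      by (auto simp: shift_copies_def split: if_splits)
  qed
  moreover have "shift_copies B p w x \<in> blowup_verts V w" if "x \<in> blowup_verts V w'" for x
  proof -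
    obtain v j where x: "x = (v, j)" by fastforce
    have "v \<in> V" "j < w' v" "v \<notin> A"
      using that notA unfolding x by (auto simp: blowup_verts_def)
    then show ?thesis
      using pA[of v] wB[of v] wo[of v] sub
      by (cases "v \<in> B") (auto simp: x shift_copies_def blowup_verts_def)
  qed
  moreover have "x \<in> shift_copies B p w ` blowup_verts V w'" if "x \<in> blowup_verts V w" for x
  proof -
    obtain v j where x: "x = (v, j)" by fastforce
    have vj: "v \<in> V" "j < w v"
      using that unfolding x by (auto simp: blowup_verts_def)
    show ?thesis
    proof (cases "v \<in> A")
      case True
      then obtain u where "u \<in> B" "v = p u"
        using p by (auto simp: bij_betw_def)
      \<comment> \<open>The preimage is the extra copy of \<open>u\<close> numbered
        \<open>j\<close>, counting from 0 after the \<open>w u\<close> original ones.\<close>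
      then have "(u, w u + j) \<in> blowup_verts V w'" "x = shift_copies B p w (u, w u + j)"
        using vj wB[of u] sub by (auto simp: x shift_copies_def blowup_verts_def)
      then show ?thesis by blast
    next
      case False
      then have "(v, j) \<in> blowup_verts V w'" "x = shift_copies B p w (v, j)"
        using vj wB[of v] wo[of v] by (cases "v \<in> B"; auto simp: x shift_copies_def blowup_verts_def)+
      then show ?thesis by blast
    qed
  qed
  ultimately show ?thesis
    by (auto simp: bij_betw_def)
qed

lemma shift_copies_edge:
  assumes maps: "shift_copies B p w ` blowup_verts V w' \<subseteq> blowup_verts V w"
    and inj: "inj_on (shift_copies B p w) (blowup_verts V w')"
    and edge: "\<And>v. v \<in> B \<Longrightarrow> {p v, v} \<in> E" and indep: "indep B E"
    and nb: "\<And>v. v \<in> B \<Longrightarrow> nbrs E v - (A \<union> {v \<in> V. w v = 0}) \<subseteq> nbrs E (p v)"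
    and wA: "\<And>v. v \<in> A \<Longrightarrow> w' v = 0"
    and wo: "\<And>v. v \<in> V - (A \<union> B) \<Longrightarrow> w' v = w v"
    and xy: "{x, y} \<in> blowup_edges V E w'"
  shows "{shift_copies B p w x, shift_copies B p w y} \<in> blowup_edges V E w"
proof -
  obtain u i v j where x: "x = (u, i)" and y: "y = (v, j)" by fastforce
  have mem: "x \<in> blowup_verts V w'" "y \<in> blowup_verts V w'" "x \<noteq> y"
    and adj: "u = v \<or> {u, v} \<in> E"
    using xy by (auto simp: doubleton_mem_blowup_edges_iff x y)
  \<comment> \<open>Independence keeps \<open>t\<close> out of \<open>B\<close>, and positive new
    weight keeps it out of \<open>A\<close>. Hence \<open>w t = w' t\<close> is positive and the
    neighbourhood inclusion applies.\<close>
  have cross: "{p s, t} \<in> E"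
    if "s \<in> B" "t \<in> V" "w' t \<noteq> 0" "s \<noteq> t" "{s, t} \<in> E" for s t
  proof -
    have "t \<notin> B" using that indep by (auto simp: indep_def)
    moreover have "t \<notin> A" using that wA by auto
    ultimately have "t \<in> nbrs E s - (A \<union> {v \<in> V. w v = 0})"
      using that wo[of t] by (auto simp: nbrs_def insert_commute)
    then show ?thesis
      using nb[OF \<open>s \<in> B\<close>] by (auto simp: nbrs_def insert_commute)
  qed
  have V: "u \<in> V" "v \<in> V" "w' u \<noteq> 0" "w' v \<noteq> 0"
    using mem by (auto simp: x y blowup_verts_def)
  have "fst (shift_copies B p w x) = fst (shift_copies B p w y) \<or>
      {fst (shift_copies B p w x), fst (shift_copies B p w y)} \<in> E"
  proof (cases "u = v")
    \<comment> \<open>If just one of the two copies moves, they land over \<open>p v\<close> and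
      \<open>v\<close>, which \<open>edge\<close> joins.\<close>
    case True
    then show ?thesis
      using edge[of v] by (auto simp: x y shift_copies_def insert_commute)
  next
    case False
    then have uv: "{u, v} \<in> E" "{v, u} \<in> E" using adj by (auto simp: insert_commute)
    \<comment> \<open>So at most one endpoint moves, and a single use of \<open>cross\<close>
      suffices.\<close>
    then have "u \<notin> B \<or> v \<notin> B" using indep False by (auto simp: indep_def)
    then show ?thesis
      using cross[of u v] cross[of v u] V uv False
      by (auto simp: x y shift_copies_def insert_commute)
  qed
  moreover have "shift_copies B p w x \<noteq> shift_copies B p w y"
    using inj mem by (auto dest: inj_onD)
  ultimately show ?thesis
    using mem maps by (auto simp: doubleton_mem_blowup_edges_iff)
qed

theorem lemma3:
  fixes V :: "'a set" and E :: "'a set set" and w w' :: "'a \<Rightarrow> nat"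
    and m k r :: nat and A B :: "'a set" and a b :: "nat \<Rightarrow> 'a"
  assumes "m \<ge> 1" and "k \<ge> 2"
    and "simple_graph V E"
    and "weighting V w m"
    and "A = a ` {1..r}" and "B = b ` {1..r}"
    and "card A = r" and "card B = r"
    and "A \<subseteq> V" and "B \<subseteq> V" and "A \<inter> B = {}"
    and "\<And>i. i \<in> {1..r} \<Longrightarrow> {a i, b i} \<in> E"
    and "indep B E"
    and "\<And>i. i \<in> {1..r} \<Longrightarrow> nbrs E (b i) - (A \<union> {v \<in> V. w v = 0}) \<subseteq> nbrs E (a i)"
    and "\<And>v. v \<in> A \<Longrightarrow> w' v = 0"
    and "\<And>i. i \<in> {1..r} \<Longrightarrow> w' (b i) = w (b i) + w (a i)"
    and "\<And>v. v \<in> V - (A \<union> B) \<Longrightarrow> w' v = w v"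
  shows "weighting V w' m \<and>
    num_cliques k (blowup_verts V w') (blowup_edges V E w')
      \<le> num_cliques k (blowup_verts V w) (blowup_edges V E w)"
proof -
  have inj_a: "inj_on a {1..r}" and inj_b: "inj_on b {1..r}"
    using assms(5-8) by (auto intro: eq_card_imp_inj_on)
  \<comment> \<open>The pairing of \<open>b\<^sub>i\<close> with \<open>a\<^sub>i\<close> becomes a
    map on \<open>B\<close>, well defined since \<open>b\<close> is injective on the
    indices.\<close>
  define p where "p = a \<circ> the_inv_into {1..r} b"
  have p: "bij_betw p B A"
    unfolding p_def assms(5,6)
    by (intro bij_betw_trans[OF bij_betw_the_inv_into] inj_on_imp_bij_betw inj_a inj_b)
  have pb: "p (b i) = a i" if "i \<in> {1..r}" for i
    using that inj_b by (simp add: p_def the_inv_into_f_f)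
  have wB: "w' v = w v + w (p v)" and edge: "{p v, v} \<in> E"
    and nb: "nbrs E v - (A \<union> {v \<in> V. w v = 0}) \<subseteq> nbrs E (p v)" if v: "v \<in> B" for v
  proof -
    obtain i where i: "i \<in> {1..r}" "v = b i"
      using v assms(6) by blast
    show "w' v = w v + w (p v)" "{p v, v} \<in> E"
      "nbrs E v - (A \<union> {v \<in> V. w v = 0}) \<subseteq> nbrs E (p v)"
      unfolding i(2) pb[OF i(1)] using assms(12,14,16)[OF i(1)] by auto
  qed
  have bij: "bij_betw (shift_copies B p w) (blowup_verts V w') (blowup_verts V w)"
    using p assms(9,10,15) wB assms(17) by (rule bij_betw_shift_copies)
  have card: "card (blowup_verts V w) = m"
    using weighting_iff_card_blowup_verts assms(1,4) by blast
  then have "weighting V w' m"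
    using bij_betw_same_card[OF bij] by (simp add: weighting_iff_card_blowup_verts[OF assms(1)])
  moreover have "num_cliques k (blowup_verts V w') (blowup_edges V E w')
      \<le> num_cliques k (blowup_verts V w) (blowup_edges V E w)"
  proof (rule num_cliques_mono_inj_hom)
    show "finite (blowup_verts V w)"
      using card assms(1) by (intro card_ge_0_finite) simp
    show inj: "inj_on (shift_copies B p w) (blowup_verts V w')"
      and sub: "shift_copies B p w ` blowup_verts V w' \<subseteq> blowup_verts V w"
      using bij by (auto simp: bij_betw_def)
    show "{shift_copies B p w x, shift_copies B p w y} \<in> blowup_edges V E w"
      if "{x, y} \<in> blowup_edges V E w'" for x y
      using sub inj edge assms(13) nb assms(15,17) that by (rule shift_copies_edge)
  qed
  ultimately show ?thesis ..
qed

end
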